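(* Every strongly $\Delta$-clean ring is right quasi-duo and left quasi-duo.
   Context: Rings are associative with identity, not necessarily commutative. $U(R)$ is the group of units of $R$. Define $\Delta(R)=\{x\in R \mid 1-xu\in U(R)\text{ for all }u\in U(R)\}$. A ring $R$ is strongly $\Delta$-clean if every $a\in R$ can be written $a=e+d$ with $e^2=e\in R$, $d\in\Delta(R)$ and $ed=de$. A ring $R$ is right (resp., left) quasi-duo if every maximal right (resp., left) ideal of $R$ is a two-sided ideal. *)

theory Defs
  imports "HOL-Algebra.Ideal"
begin

definition Delta :: "('a, 'm) ring_scheme \<Rightarrow> 'a set"
  where "Delta R =
    {x \<in> carrier R. \<forall>u \<in> Units R. \<one>\<^bsub>R\<^esub> \<ominus>\<^bsub>R\<^esub> (x \<otimes>\<^bsub>R\<^esub> u) \<in> Units R}"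

locale strongly_Delta_clean_ring = ring +
  assumes strongly_Delta_clean:
    "a \<in> carrier R \<Longrightarrow>
      \<exists>e d. e \<in> carrier R \<and> e \<otimes> e = e \<and> d \<in> Delta R \<and> a = e \<oplus> d \<and> e \<otimes> d = d \<otimes> e"

locale right_ideal = additive_subgroup I R + ring R for I and R (structure) +
  assumes right_closed: "\<lbrakk>a \<in> I; x \<in> carrier R\<rbrakk> \<Longrightarrow> a \<otimes> x \<in> I"

locale left_ideal = additive_subgroup I R + ring R for I and R (structure) +
  assumes left_closed: "\<lbrakk>a \<in> I; x \<in> carrier R\<rbrakk> \<Longrightarrow> x \<otimes> a \<in> I"

locale maximal_right_ideal = right_ideal +
  assumes right_notcarr: "carrier R \<noteq> I"
    and right_maximal:
      "\<lbrakk>right_ideal J R; I \<subseteq> J; J \<subseteq> carrier R\<rbrakk> \<Longrightarrow> J = I \<or> J = carrier R"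

locale maximal_left_ideal = left_ideal +
  assumes left_notcarr: "carrier R \<noteq> I"
    and left_maximal:
      "\<lbrakk>left_ideal J R; I \<subseteq> J; J \<subseteq> carrier R\<rbrakk> \<Longrightarrow> J = I \<or> J = carrier R"

locale right_quasi_duo_ring = ring +
  assumes maximal_right_imp_ideal: "maximal_right_ideal I R \<Longrightarrow> ideal I R"

locale left_quasi_duo_ring = ring +
  assumes maximal_left_imp_ideal: "maximal_left_ideal I R \<Longrightarrow> ideal I R"

end

theory Submission
  imports Defs
begin

text \<open>
  In a strongly \<open>\<Delta>\<close>-clean ring every unit lies in \<open>1 + \<Delta>(R)\<close>, so \<open>\<Delta>(R)\<close>, which is closed under
  sums and products, contains all square-zero elements. For an idempotent \<open>e\<close> and \<open>x \<in> eR(1-e)\<close>,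
  \<open>y \<in> (1-e)Re\<close> the product \<open>xy\<close> of two square-zero elements is therefore in \<open>\<Delta>(R)\<close>, so \<open>1 - xy\<close>
  is a unit; this puts \<open>eR(1-e)\<close> into the Jacobson radical \<open>J\<close>. Thus idempotents are central
  modulo \<open>J\<close>, which yields \<open>e\<Delta>(R) \<subseteq> \<Delta>(R)\<close>, then \<open>R\<Delta>(R) \<subseteq> \<Delta>(R)\<close> and \<open>\<Delta>(R) = J\<close>. Hence \<open>R/J\<close> is
  Boolean, so commutative, and every maximal one-sided ideal, as it contains \<open>J\<close>, is two-sided.
\<close>

text \<open>Quasi-regularity description of the Jacobson radical, free of maximal ideals. It is the
  formula of \<open>Delta R\<close> with the multiplier ranging over the whole carrier instead of
  the units.\<close>

definition jacobson_radical :: "('a, 'm) ring_scheme \<Rightarrow> 'a set"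
  where "jacobson_radical R =
    {x \<in> carrier R. \<forall>r \<in> carrier R. \<one>\<^bsub>R\<^esub> \<ominus>\<^bsub>R\<^esub> (x \<otimes>\<^bsub>R\<^esub> r) \<in> Units R}"

section \<open>Recognising units\<close>

text \<open>The two products supply a right inverse \<open>?q\<close> and a left inverse
  \<open>?r\<close> of \<open>p\<close>; these must coincide.\<close>

lemma (in monoid) Units_if_mult_Units:
  assumes "p \<otimes> q \<in> Units G" "r \<otimes> p \<in> Units G"
    and [simp]: "p \<in> carrier G" "q \<in> carrier G" "r \<in> carrier G"
  shows "p \<in> Units G"
proof -
  let ?q = "q \<otimes> inv (p \<otimes> q)" and ?r = "inv (r \<otimes> p) \<otimes> r"
  have inv_closed [simp]: "inv (p \<otimes> q) \<in> carrier G" "inv (r \<otimes> p) \<in> carrier G"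
    using assms(1,2) by auto
  have pq: "p \<otimes> ?q = \<one>"
    using Units_r_inv[OF assms(1)] by (simp add: m_assoc)
  have rp: "?r \<otimes> p = \<one>"
    using Units_l_inv[OF assms(2)] by (simp add: m_assoc)
  have "?r = ?q"
    using inv_unique[OF rp pq] by simp
  with pq rp show ?thesis
    unfolding Units_def by (auto intro!: bexI[of _ ?q])
qed

context ring
begin

text \<open>The library's normalisation rules for non-commutative rings lack the right unit law.\<close>

lemmas [algebra add: ring "zero R" "add R" "a_inv R" "a_minus R" "one R" "mult R"] = r_one

text \<open>Jacobson's lemma: if \<open>c\<close> inverts 1 - ab, then 1 + bca inverts 1 - ba, as
  the formal geometric series suggests.\<close>

lemma Units_one_minus_swap:
  assumes [simp]: "a \<in> carrier R" "b \<in> carrier R"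
    and unit: "\<one> \<ominus> a \<otimes> b \<in> Units R"
  shows "\<one> \<ominus> b \<otimes> a \<in> Units R"
proof -
  define c where "c = inv (\<one> \<ominus> a \<otimes> b)"
  have [simp]: "c \<in> carrier R"
    using unit by (simp add: c_def)
  have r: "(\<one> \<ominus> a \<otimes> b) \<otimes> c = \<one>" and l: "c \<otimes> (\<one> \<ominus> a \<otimes> b) = \<one>"
    using unit by (simp_all add: c_def)
  have "(\<one> \<ominus> b \<otimes> a) \<otimes> (\<one> \<oplus> b \<otimes> c \<otimes> a) = \<one> \<ominus> b \<otimes> a \<oplus> b \<otimes> ((\<one> \<ominus> a \<otimes> b) \<otimes> c) \<otimes> a"
    using assms(1,2) \<open>c \<in> carrier R\<close> by algebra
  also have "\<dots> = \<one>"
    unfolding r using assms(1,2) by algebra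
  finally have R: "(\<one> \<ominus> b \<otimes> a) \<otimes> (\<one> \<oplus> b \<otimes> c \<otimes> a) = \<one>" .
  have "(\<one> \<oplus> b \<otimes> c \<otimes> a) \<otimes> (\<one> \<ominus> b \<otimes> a) = \<one> \<ominus> b \<otimes> a \<oplus> b \<otimes> (c \<otimes> (\<one> \<ominus> a \<otimes> b)) \<otimes> a"
    using assms(1,2) \<open>c \<in> carrier R\<close> by algebra
  also have "\<dots> = \<one>"
    unfolding l using assms(1,2) by algebra
  finally have L: "(\<one> \<oplus> b \<otimes> c \<otimes> a) \<otimes> (\<one> \<ominus> b \<otimes> a) = \<one>" .
  show ?thesis
    unfolding Units_def using R L by (auto intro!: bexI[of _ "\<one> \<oplus> b \<otimes> c \<otimes> a"])
qed

section \<open>Closure properties of \<open>Delta R\<close>\<close>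

lemma DeltaD:
  "x \<in> Delta R \<Longrightarrow> x \<in> carrier R"
  "\<lbrakk>x \<in> Delta R; u \<in> Units R\<rbrakk> \<Longrightarrow> \<one> \<ominus> x \<otimes> u \<in> Units R"
  by (auto simp: Delta_def)

text \<open>Factor out the unit on the right: u - x = (1 - x \<open>inv u\<close>) u.\<close>

lemma Units_minus_Delta:
  assumes "u \<in> Units R" "x \<in> Delta R"
  shows "u \<ominus> x \<in> Units R"
proof -
  have c: "u \<in> carrier R" "x \<in> carrier R" "inv u \<in> carrier R"
    using assms DeltaD by auto
  have "(\<one> \<ominus> x \<otimes> inv u) \<otimes> u = u \<ominus> x \<otimes> (inv u \<otimes> u)"
    using c by algebra
  also have "\<dots> = u \<ominus> x"
    using assms c by simp
  finally show ?thesis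
    using Units_m_closed[OF DeltaD(2)[OF assms(2), of "inv u"] assms(1)] assms(1) by simp
qed

lemma Delta_mult_Units:
  assumes "x \<in> Delta R" "v \<in> Units R"
  shows "x \<otimes> v \<in> Delta R"
  using assms DeltaD[OF assms(1)] by (auto simp: Delta_def m_assoc Units_closed)

lemma Delta_minus:
  assumes "x \<in> Delta R"
  shows "\<ominus> x \<in> Delta R"
proof -
  have "x \<otimes> (\<ominus> \<one>) = \<ominus> x"
    using DeltaD(1)[OF assms] by algebra
  then show ?thesis
    using Delta_mult_Units[OF assms Units_minus_one_closed] by simp
qed

lemma Delta_add:
  assumes "x \<in> Delta R" "y \<in> Delta R"
  shows "x \<oplus> y \<in> Delta R"
proof -
  have c: "x \<in> carrier R" "y \<in> carrier R"
    using assms DeltaD by auto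
  have "\<one> \<ominus> (x \<oplus> y) \<otimes> u \<in> Units R" if u: "u \<in> Units R" for u
  proof -
    have "\<one> \<ominus> (x \<oplus> y) \<otimes> u = (\<one> \<ominus> x \<otimes> u) \<ominus> y \<otimes> u"
      using c Units_closed[OF u] by algebra
    then show ?thesis
      using Units_minus_Delta[OF DeltaD(2)[OF assms(1) u] Delta_mult_Units[OF assms(2) u]] by simp
  qed
  with c show ?thesis by (simp add: Delta_def)
qed

text \<open>Since 1 - y is a unit, xy = x - x(1 - y) reduces products to sums and to multiplication
  by units.\<close>

lemma Delta_mult:
  assumes "x \<in> Delta R" "y \<in> Delta R"
  shows "x \<otimes> y \<in> Delta R"
proof -
  have c: "x \<in> carrier R" "y \<in> carrier R"
    using assms DeltaD by auto
  have "\<one> \<ominus> y \<in> Units R"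
    using Units_minus_Delta[OF Units_one_closed assms(2)] .
  then have "x \<oplus> \<ominus> (x \<otimes> (\<one> \<ominus> y)) \<in> Delta R"
    using assms(1) by (intro Delta_add Delta_minus Delta_mult_Units)
  moreover have "x \<oplus> \<ominus> (x \<otimes> (\<one> \<ominus> y)) = x \<otimes> y"
    using c by algebra
  ultimately show ?thesis by simp
qed

section \<open>The Jacobson radical is a two-sided ideal\<close>

lemma jacobson_radicalD:
  "x \<in> jacobson_radical R \<Longrightarrow> x \<in> carrier R"
  "\<lbrakk>x \<in> jacobson_radical R; r \<in> carrier R\<rbrakk> \<Longrightarrow> \<one> \<ominus> x \<otimes> r \<in> Units R"
  by (auto simp: jacobson_radical_def)

lemma jacobson_radical_r_closed:
  assumes "x \<in> jacobson_radical R" "r \<in> carrier R"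
  shows "x \<otimes> r \<in> jacobson_radical R"
  using assms jacobson_radicalD[OF assms(1)] by (auto simp: jacobson_radical_def m_assoc)

text \<open>The definition speaks of right multiples only; \<open>Units_one_minus_swap\<close>
  carries \<open>r\<close> from the right end to the left.\<close>

lemma jacobson_radical_l_closed:
  assumes "x \<in> jacobson_radical R" "r \<in> carrier R"
  shows "r \<otimes> x \<in> jacobson_radical R"
proof -
  have x: "x \<in> carrier R"
    using assms jacobson_radicalD by auto
  have "\<one> \<ominus> r \<otimes> x \<otimes> s \<in> Units R" if s: "s \<in> carrier R" for s
  proof -
    have "\<one> \<ominus> (x \<otimes> s) \<otimes> r \<in> Units R"
      using jacobson_radicalD(2)[OF assms(1), of "s \<otimes> r"] assms x s by (simp add: m_assoc)
    from Units_one_minus_swap[OF _ _ this] show ?thesis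
      using assms x s by (simp add: m_assoc)
  qed
  with x assms show ?thesis by (simp add: jacobson_radical_def)
qed

lemma one_minus_jacobson_radical:
  assumes "x \<in> jacobson_radical R"
  shows "\<one> \<ominus> x \<in> Units R"
  using jacobson_radicalD[OF assms] by (metis one_closed r_one)

lemma Units_minus_jacobson_radical:
  assumes "u \<in> Units R" "x \<in> jacobson_radical R"
  shows "u \<ominus> x \<in> Units R"
proof -
  have c: "u \<in> carrier R" "x \<in> carrier R" "inv u \<in> carrier R"
    using assms jacobson_radicalD by auto
  have "(\<one> \<ominus> x \<otimes> inv u) \<otimes> u = u \<ominus> x \<otimes> (inv u \<otimes> u)"
    using c by algebra
  also have "\<dots> = u \<ominus> x"
    using assms c by simp
  finally show ?thesis
    using Units_m_closed[OF jacobson_radicalD(2)[OF assms(2) c(3)] assms(1)] by simp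
qed

lemma jacobson_radical_minus:
  assumes "x \<in> jacobson_radical R"
  shows "\<ominus> x \<in> jacobson_radical R"
proof -
  have "x \<otimes> (\<ominus> \<one>) = \<ominus> x"
    using jacobson_radicalD(1)[OF assms] by algebra
  then show ?thesis
    using jacobson_radical_r_closed[OF assms, of "\<ominus> \<one>"] by simp
qed

lemma jacobson_radical_add:
  assumes "x \<in> jacobson_radical R" "y \<in> jacobson_radical R"
  shows "x \<oplus> y \<in> jacobson_radical R"
proof -
  have c: "x \<in> carrier R" "y \<in> carrier R"
    using assms jacobson_radicalD by auto
  have "\<one> \<ominus> (x \<oplus> y) \<otimes> r \<in> Units R" if r: "r \<in> carrier R" for r
  proof -
    have "\<one> \<ominus> (x \<oplus> y) \<otimes> r = (\<one> \<ominus> x \<otimes> r) \<ominus> y \<otimes> r"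
      using c r by algebra
    then show ?thesis
      using Units_minus_jacobson_radical[OF jacobson_radicalD(2)[OF assms(1) r]
          jacobson_radical_r_closed[OF assms(2) r]] by simp
  qed
  with c show ?thesis by (simp add: jacobson_radical_def)
qed

lemma jacobson_radical_diff:
  assumes "x \<in> jacobson_radical R" "y \<in> jacobson_radical R"
  shows "x \<ominus> y \<in> jacobson_radical R"
  using jacobson_radical_add[OF assms(1) jacobson_radical_minus[OF assms(2)]] by (simp add: minus_eq)

lemma ideal_jacobson_radical: "ideal (jacobson_radical R) R"
proof (rule idealI[OF ring_axioms])
  show "subgroup (jacobson_radical R) (add_monoid R)"
  proof (rule add.subgroupI)
    have "\<zero> \<in> jacobson_radical R"
      by (simp add: jacobson_radical_def minus_eq)
    then show "jacobson_radical R \<noteq> {}" by auto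
  qed (auto simp: jacobson_radicalD jacobson_radical_add jacobson_radical_minus
      simp flip: a_inv_def)
qed (fact jacobson_radical_l_closed jacobson_radical_r_closed)+

section \<open>Maximal one-sided ideals contain the radical\<close>

lemma right_ideal_carrier_if_Unit:
  assumes "right_ideal I R" "u \<in> I" "u \<in> Units R"
  shows "I = carrier R"
proof -
  interpret I: right_ideal I R by fact
  have "\<one> \<in> I"
    using I.right_closed[OF assms(2), of "inv u"] assms(3) by simp
  then show ?thesis
    using I.right_closed[of \<one>] I.a_subset by auto
qed

lemma left_ideal_carrier_if_Unit:
  assumes "left_ideal I R" "u \<in> I" "u \<in> Units R"
  shows "I = carrier R"
proof -
  interpret I: left_ideal I R by fact
  have "\<one> \<in> I"
    using I.left_closed[OF assms(2), of "inv u"] assms(3) by simp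
  then show ?thesis
    using I.left_closed[of \<one>] I.a_subset by auto
qed

text \<open>If 1 = i + x with \<open>x\<close> in the radical, then i = 1 - x would be a unit in
  \<open>I\<close>.\<close>

lemma jacobson_radical_add_proper:
  assumes "I \<subseteq> carrier R" "I \<inter> Units R = {}"
  shows "I <+> jacobson_radical R \<noteq> carrier R"
proof
  assume "I <+> jacobson_radical R = carrier R"
  then obtain i x where ix: "i \<in> I" "x \<in> jacobson_radical R" "\<one> = i \<oplus> x"
    using one_closed unfolding set_add_def' by blast
  have c: "i \<in> carrier R" "x \<in> carrier R"
    using ix assms(1) jacobson_radicalD by auto
  have "\<one> \<ominus> x = i"
    unfolding ix(3) using c by algebra
  then have "i \<in> Units R"
    using one_minus_jacobson_radical[OF ix(2)] by simp
  with ix(1) assms(2) show False by auto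
qed

lemma subset_set_add:
  assumes "additive_subgroup H R" "additive_subgroup K R"
  shows "H \<subseteq> H <+> K" "K \<subseteq> H <+> K"
proof -
  interpret H: additive_subgroup H R by fact
  interpret K: additive_subgroup K R by fact
  have "h = h \<oplus> \<zero>" if "h \<in> H" for h
    using that H.a_subset by auto
  then show "H \<subseteq> H <+> K"
    unfolding set_add_def' using K.zero_closed by blast
  have "k = \<zero> \<oplus> k" if "k \<in> K" for k
    using that K.a_subset by auto
  then show "K \<subseteq> H <+> K"
    unfolding set_add_def' using H.zero_closed by blast
qed

text \<open>The sum \<open>?K\<close> of \<open>I\<close> and the radical is a proper right ideal
  above \<open>I\<close>, so maximality forces \<open>?K = I\<close>.\<close>

lemma jacobson_radical_subset_maximal_right_ideal:
  assumes "maximal_right_ideal I R"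
  shows "jacobson_radical R \<subseteq> I"
proof -
  interpret I: maximal_right_ideal I R by fact
  interpret J: ideal "jacobson_radical R" R by (fact ideal_jacobson_radical)
  let ?K = "set_add R I (jacobson_radical R)"
  have "right_ideal ?K R"
  proof (intro right_ideal.intro right_ideal_axioms.intro ring_axioms)
    show "additive_subgroup ?K R"
      by (rule add_additive_subgroups) unfold_locales
    fix a r assume "a \<in> ?K" and r: "r \<in> carrier R"
    then obtain i x where ix: "i \<in> I" "x \<in> jacobson_radical R" "a = i \<oplus> x"
      unfolding set_add_def' by blast
    then have "a \<otimes> r = i \<otimes> r \<oplus> x \<otimes> r"
      using r by (auto intro: l_distr)
    with I.right_closed[OF ix(1) r] J.I_r_closed[OF ix(2) r] show "a \<otimes> r \<in> ?K"
      unfolding set_add_def' by blast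
  qed
  moreover have "I \<subseteq> ?K" and "jacobson_radical R \<subseteq> ?K"
    using subset_set_add[OF I.additive_subgroup_axioms J.additive_subgroup_axioms] by auto
  moreover have "?K \<subseteq> carrier R"
    using I.a_subset J.a_subset by (rule set_add_closed)
  \<comment> \<open>A proper right ideal contains no unit, which is the disjointness needed
    here.\<close>
  moreover have "?K \<noteq> carrier R"
    using I.right_notcarr right_ideal_carrier_if_Unit[OF I.right_ideal_axioms] I.a_subset
    by (intro jacobson_radical_add_proper) auto
  ultimately show ?thesis
    using I.right_maximal[of ?K] by auto
qed

lemma jacobson_radical_subset_maximal_left_ideal:
  assumes "maximal_left_ideal I R"
  shows "jacobson_radical R \<subseteq> I"
proof -
  interpret I: maximal_left_ideal I R by fact
  interpret J: ideal "jacobson_radical R" R by (fact ideal_jacobson_radical)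
  let ?K = "set_add R I (jacobson_radical R)"
  have "left_ideal ?K R"
  proof (intro left_ideal.intro left_ideal_axioms.intro ring_axioms)
    show "additive_subgroup ?K R"
      by (rule add_additive_subgroups) unfold_locales
    fix a r assume "a \<in> ?K" and r: "r \<in> carrier R"
    then obtain i x where ix: "i \<in> I" "x \<in> jacobson_radical R" "a = i \<oplus> x"
      unfolding set_add_def' by blast
    then have "r \<otimes> a = r \<otimes> i \<oplus> r \<otimes> x"
      using r by (auto intro: r_distr)
    with I.left_closed[OF ix(1) r] J.I_l_closed[OF ix(2) r] show "r \<otimes> a \<in> ?K"
      unfolding set_add_def' by blast
  qed
  moreover have "I \<subseteq> ?K" and "jacobson_radical R \<subseteq> ?K"
    using subset_set_add[OF I.additive_subgroup_axioms J.additive_subgroup_axioms] by auto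
  moreover have "?K \<subseteq> carrier R"
    using I.a_subset J.a_subset by (rule set_add_closed)
  moreover have "?K \<noteq> carrier R"
    using I.left_notcarr left_ideal_carrier_if_Unit[OF I.left_ideal_axioms] I.a_subset
    by (intro jacobson_radical_add_proper) auto
  ultimately show ?thesis
    using I.left_maximal[of ?K] by auto
qed

section \<open>From Boolean modulo the radical to quasi-duo\<close>

text \<open>The classical argument that Boolean rings are commutative, with each equation replaced
  by membership of the defect \<open>?q\<close> in the radical.\<close>

lemma commutator_in_jacobson_radical:
  assumes boolean: "\<And>a. a \<in> carrier R \<Longrightarrow> a \<otimes> a \<ominus> a \<in> jacobson_radical R"
    and ab: "a \<in> carrier R" "b \<in> carrier R"
  shows "a \<otimes> b \<ominus> b \<otimes> a \<in> jacobson_radical R"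
proof -
  let ?q = "\<lambda>a. a \<otimes> a \<ominus> a"
  let ?c = "b \<otimes> a"
  \<comment> \<open>Characteristic two modulo the radical: the squares cancel and 2c
    remains.\<close>
  have "?q (\<ominus> ?c) \<ominus> ?q ?c = ?c \<oplus> ?c"
    using ab by algebra
  then have two: "?c \<oplus> ?c \<in> jacobson_radical R"
    using jacobson_radical_diff[OF boolean[of "\<ominus> ?c"] boolean[of ?c]] ab by simp
  \<comment> \<open>This element is ab + ba; removing 2ba turns it into the commutator.\<close>
  have "?q (a \<oplus> b) \<ominus> ?q a \<ominus> ?q b \<in> jacobson_radical R"
    using ab by (intro jacobson_radical_diff boolean) auto
  from jacobson_radical_diff[OF this two] have
    "?q (a \<oplus> b) \<ominus> ?q a \<ominus> ?q b \<ominus> (?c \<oplus> ?c) \<in> jacobson_radical R" .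
  moreover have "?q (a \<oplus> b) \<ominus> ?q a \<ominus> ?q b \<ominus> (?c \<oplus> ?c) = a \<otimes> b \<ominus> b \<otimes> a"
    using ab by algebra
  ultimately show ?thesis by simp
qed

lemma quasi_duo_if_commutative_mod_jacobson_radical:
  assumes "\<And>a b. \<lbrakk>a \<in> carrier R; b \<in> carrier R\<rbrakk> \<Longrightarrow> a \<otimes> b \<ominus> b \<otimes> a \<in> jacobson_radical R"
  shows "right_quasi_duo_ring R" "left_quasi_duo_ring R"
proof -
  \<comment> \<open>As \<open>I\<close> contains all commutators, absorption on one side yields
    absorption on the other.\<close>
  have swap: "b \<otimes> a \<in> I"
    if I: "additive_subgroup I R" "jacobson_radical R \<subseteq> I"
      and ab: "a \<in> carrier R" "b \<in> carrier R" "a \<otimes> b \<in> I" for I a b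
  proof -
    interpret I: additive_subgroup I R by fact
    have "b \<otimes> a \<ominus> a \<otimes> b \<in> I"
      using assms[of b a] I ab by auto
    from I.a_closed[OF this ab(3)] have "b \<otimes> a \<ominus> a \<otimes> b \<oplus> a \<otimes> b \<in> I" .
    moreover have "b \<otimes> a \<ominus> a \<otimes> b \<oplus> a \<otimes> b = b \<otimes> a"
      using ab(1,2) by algebra
    ultimately show ?thesis by simp
  qed
  show "right_quasi_duo_ring R"
  proof (rule right_quasi_duo_ring.intro[OF ring_axioms], rule right_quasi_duo_ring_axioms.intro)
    fix I assume max: "maximal_right_ideal I R"
    then interpret I: maximal_right_ideal I R .
    show "ideal I R"
      using swap[OF I.additive_subgroup_axioms jacobson_radical_subset_maximal_right_ideal[OF max]]
        I.right_closed I.a_subset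
      by (intro idealI[OF ring_axioms I.a_subgroup]) auto
  qed
  show "left_quasi_duo_ring R"
  proof (rule left_quasi_duo_ring.intro[OF ring_axioms], rule left_quasi_duo_ring_axioms.intro)
    fix I assume max: "maximal_left_ideal I R"
    then interpret I: maximal_left_ideal I R .
    show "ideal I R"
      using swap[OF I.additive_subgroup_axioms jacobson_radical_subset_maximal_left_ideal[OF max]]
        I.left_closed I.a_subset
      by (intro idealI[OF ring_axioms I.a_subgroup]) auto
  qed
qed

section \<open>Idempotents and their complements\<close>

lemma idem_complement:
  assumes [simp]: "e \<in> carrier R" and e: "e \<otimes> e = e"
  shows "(\<one> \<ominus> e) \<otimes> e = \<zero>" "e \<otimes> (\<one> \<ominus> e) = \<zero>" "(\<one> \<ominus> e) \<otimes> (\<one> \<ominus> e) = \<one> \<ominus> e"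
proof -
  have "(\<one> \<ominus> e) \<otimes> e = e \<ominus> e \<otimes> e" "e \<otimes> (\<one> \<ominus> e) = e \<ominus> e \<otimes> e"
    using assms(1) by algebra+
  then show 0: "(\<one> \<ominus> e) \<otimes> e = \<zero>" "e \<otimes> (\<one> \<ominus> e) = \<zero>"
    by (simp_all add: e r_neg minus_eq)
  have "(\<one> \<ominus> e) \<otimes> (\<one> \<ominus> e) = (\<one> \<ominus> e) \<ominus> (\<one> \<ominus> e) \<otimes> e"
    using assms(1) by algebra
  then show "(\<one> \<ominus> e) \<otimes> (\<one> \<ominus> e) = \<one> \<ominus> e"
    unfolding 0 by (simp add: minus_eq)
qed

lemma Units_idem_imp_one:
  assumes "e \<in> Units R" "e \<otimes> e = e"
  shows "e = \<one>"
  using assms Units_l_cancel[of e e \<one>] by (simp add: Units_closed)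

end

section \<open>Units and square-zero elements under the clean decomposition\<close>

context strongly_Delta_clean_ring
begin

text \<open>In u = e + d the idempotent e = u - d is again a unit, hence 1, so u - 1 = d.\<close>

lemma Units_minus_one_in_Delta:
  assumes u: "u \<in> Units R"
  shows "u \<ominus> \<one> \<in> Delta R"
proof -
  obtain e d where ed: "e \<in> carrier R" "e \<otimes> e = e" "d \<in> Delta R" "u = e \<oplus> d"
    using strongly_Delta_clean Units_closed[OF u] by blast
  have d: "d \<in> carrier R" using ed DeltaD by auto
  have "u \<ominus> d = e"
    unfolding ed(4) using ed(1) d by algebra
  then have "e = \<one>"
    using Units_minus_Delta[OF u ed(3)] ed(2) Units_idem_imp_one by simp
  then have "u \<ominus> \<one> = d"
    unfolding ed(4) using d by algebra
  with ed(3) show ?thesis by simp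
qed

text \<open>1 + x is a unit with inverse 1 - x, so the preceding lemma applies to it.\<close>

lemma square_zero_in_Delta:
  assumes x: "x \<in> carrier R" "x \<otimes> x = \<zero>"
  shows "x \<in> Delta R"
proof -
  have "(\<one> \<oplus> x) \<otimes> (\<one> \<ominus> x) = \<one> \<ominus> x \<otimes> x" "(\<one> \<ominus> x) \<otimes> (\<one> \<oplus> x) = \<one> \<ominus> x \<otimes> x"
    using x(1) by algebra+
  then have "\<one> \<oplus> x \<in> Units R"
    unfolding Units_def using x by (auto intro!: bexI[of _ "\<one> \<ominus> x"] simp: minus_eq)
  moreover have "\<one> \<oplus> x \<ominus> \<one> = x"
    using x(1) by algebra
  ultimately show ?thesis
    using Units_minus_one_in_Delta[of "\<one> \<oplus> x"] by simp
qed

section \<open>Idempotents are central modulo the radical\<close>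

lemma idem_corner_in_jacobson_radical:
  assumes e: "e \<in> carrier R" "e \<otimes> e = e" and r: "r \<in> carrier R"
  shows "e \<otimes> r \<otimes> (\<one> \<ominus> e) \<in> jacobson_radical R"
proof -
  let ?x = "e \<otimes> r \<otimes> (\<one> \<ominus> e)"
  have x: "?x \<in> carrier R" using e r by simp
  note compl = idem_complement[OF e]
  have "\<one> \<ominus> ?x \<otimes> s \<in> Units R" if s: "s \<in> carrier R" for s
  proof -
    \<comment> \<open>Compressing \<open>s\<close> to the opposite corner makes \<open>?y\<close>
      square-zero like \<open>?x\<close>, while \<open>?x \<otimes> ?y\<close> still equals
      \<open>(?x \<otimes> s) \<otimes> e\<close>.\<close>
    let ?y = "(\<one> \<ominus> e) \<otimes> s \<otimes> e"
    have y: "?y \<in> carrier R" using e s by simp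
    have "?x \<otimes> ?x = e \<otimes> r \<otimes> ((\<one> \<ominus> e) \<otimes> e) \<otimes> (r \<otimes> (\<one> \<ominus> e))"
      using e(1) r by (simp add: m_assoc)
    then have "?x \<in> Delta R"
      unfolding compl using e(1) r x by (intro square_zero_in_Delta) simp_all
    moreover have "?y \<otimes> ?y = (\<one> \<ominus> e) \<otimes> s \<otimes> (e \<otimes> (\<one> \<ominus> e)) \<otimes> (s \<otimes> e)"
      using e(1) s by (simp add: m_assoc)
    then have "?y \<in> Delta R"
      unfolding compl using e(1) s y by (intro square_zero_in_Delta) simp_all
    ultimately have "\<one> \<ominus> ?x \<otimes> ?y \<in> Units R"
      by (intro Units_minus_Delta[OF Units_one_closed] Delta_mult[of ?x ?y])
    moreover have "?x \<otimes> ?y = (e \<otimes> r \<otimes> ((\<one> \<ominus> e) \<otimes> (\<one> \<ominus> e)) \<otimes> s) \<otimes> e"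
      using e(1) r s by (simp add: m_assoc)
    ultimately have "\<one> \<ominus> (?x \<otimes> s) \<otimes> e \<in> Units R"
      unfolding compl by simp
    \<comment> \<open>Moved to the front, \<open>e\<close> is absorbed by \<open>?x\<close>, leaving
      \<open>?x \<otimes> s\<close> with arbitrary \<open>s\<close>.\<close>
    then have "\<one> \<ominus> e \<otimes> (?x \<otimes> s) \<in> Units R"
      by (rule Units_one_minus_swap[rotated 2]) (use e(1) x s in auto)
    moreover have "e \<otimes> (?x \<otimes> s) = (e \<otimes> e) \<otimes> r \<otimes> (\<one> \<ominus> e) \<otimes> s"
      using e(1) r s by (simp add: m_assoc)
    ultimately show ?thesis by (simp add: e(2))
  qed
  with x show ?thesis by (simp add: jacobson_radical_def)
qed

lemma idem_commutes_mod_jacobson_radical: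
  assumes e: "e \<in> carrier R" "e \<otimes> e = e" and r: "r \<in> carrier R"
  shows "e \<otimes> r \<ominus> r \<otimes> e \<in> jacobson_radical R"
proof -
  let ?f = "\<one> \<ominus> e"
  have f: "?f \<in> carrier R" using e by simp
  \<comment> \<open>The same result for the complementary idempotent gives the opposite corner; er -
    re is the difference of the two corners.\<close>
  have "?f \<otimes> r \<otimes> (\<one> \<ominus> ?f) \<in> jacobson_radical R"
    using f idem_complement(3)[OF e] r by (rule idem_corner_in_jacobson_radical)
  from jacobson_radical_diff[OF idem_corner_in_jacobson_radical[OF e r] this]
  have "e \<otimes> r \<otimes> ?f \<ominus> ?f \<otimes> r \<otimes> (\<one> \<ominus> ?f) \<in> jacobson_radical R" .
  moreover have "e \<otimes> r \<otimes> ?f \<ominus> ?f \<otimes> r \<otimes> (\<one> \<ominus> ?f) = e \<otimes> r \<ominus> r \<otimes> e"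
    using e(1) r by algebra
  ultimately show ?thesis by simp
qed

section \<open>Multiplying \<open>Delta R\<close> by idempotents\<close>

text \<open>With \<open>w = 1 - du\<close>, the candidate inverse of \<open>1 - edu = 1 - e + ew\<close> modulo the Jacobson
  radical is \<open>1 - e + ew\<^sup>-\<^sup>1\<close>.\<close>

lemma idem_mult_Delta:
  assumes e: "e \<in> carrier R" "e \<otimes> e = e" and d: "d \<in> Delta R"
  shows "e \<otimes> d \<in> Delta R"
proof -
  let ?f = "\<one> \<ominus> e"
  have f: "?f \<in> carrier R" using e by simp
  have dc: "d \<in> carrier R" using d DeltaD by auto
  \<comment> \<open>Only ab = 1 is assumed, so that the pair \<open>w\<close>, \<open>inv w\<close>
    can be used in both orders.\<close>
  have prod: "(?f \<oplus> e \<otimes> a) \<otimes> (?f \<oplus> e \<otimes> b) \<in> Units R"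
    if ab: "a \<in> carrier R" "b \<in> carrier R" "a \<otimes> b = \<one>" for a b
  proof -
    \<comment> \<open>The commutator \<open>k\<close> measures how far \<open>e\<close> is from
      central; the product will be 1 - ek(1 - b), a unit because \<open>k\<close> is in the
      radical.\<close>
    define k where "k = a \<otimes> e \<ominus> e \<otimes> a"
    have kc: "k \<in> carrier R"
      using e(1) ab by (simp add: k_def)
    have "k = \<ominus> (e \<otimes> a \<ominus> a \<otimes> e)"
      unfolding k_def using e(1) ab(1) by algebra
    then have "k \<in> jacobson_radical R"
      using jacobson_radical_minus[OF idem_commutes_mod_jacobson_radical[OF e ab(1)]] by simp
    then have z: "e \<otimes> k \<otimes> (\<one> \<ominus> b) \<in> jacobson_radical R"
      using e(1) ab by (intro jacobson_radical_l_closed jacobson_radical_r_closed) auto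
    have "e \<otimes> a \<otimes> e = e \<otimes> k \<oplus> (e \<otimes> e) \<otimes> a"
      unfolding k_def using e(1) ab(1) by algebra
    then have eae: "e \<otimes> a \<otimes> e = e \<otimes> k \<oplus> e \<otimes> a"
      by (simp add: e(2))
    have "(?f \<oplus> e \<otimes> a) \<otimes> (?f \<oplus> e \<otimes> b)
      = ?f \<otimes> ?f \<oplus> (?f \<otimes> e) \<otimes> b \<oplus> e \<otimes> a \<otimes> ?f \<oplus> (e \<otimes> a \<otimes> e) \<otimes> b"
      using e(1) f ab(1,2) by (simp add: l_distr r_distr m_assoc a_ac)
    also have "e \<otimes> a \<otimes> ?f = e \<otimes> a \<ominus> e \<otimes> a \<otimes> e"
      using e(1) ab(1) by algebra
    also have "?f \<otimes> ?f \<oplus> (?f \<otimes> e) \<otimes> b \<oplus> (e \<otimes> a \<ominus> e \<otimes> a \<otimes> e) \<oplus> (e \<otimes> a \<otimes> e) \<otimes> b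
      = ?f \<ominus> e \<otimes> k \<otimes> (\<one> \<ominus> b) \<oplus> e \<otimes> (a \<otimes> b)"
    proof -
      \<comment> \<open>Naming ek and ea as \<open>p\<close> and \<open>q\<close> leaves an identity
        that no longer uses idempotence of \<open>e\<close>.\<close>
      have "?f \<oplus> \<zero> \<otimes> b \<oplus> (q \<ominus> (p \<oplus> q)) \<oplus> (p \<oplus> q) \<otimes> b = ?f \<ominus> p \<otimes> (\<one> \<ominus> b) \<oplus> q \<otimes> b"
        if "p \<in> carrier R" "q \<in> carrier R" for p q
        using that e(1) ab(2) by algebra
      from this[of "e \<otimes> k" "e \<otimes> a"] show ?thesis
        unfolding eae idem_complement[OF e] using e(1) kc ab(1,2) by (simp add: m_assoc)
    qed
    also have "\<dots> = \<one> \<ominus> e \<otimes> k \<otimes> (\<one> \<ominus> b)"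
    proof -
      have "?f \<ominus> z \<oplus> e \<otimes> \<one> = \<one> \<ominus> z" if "z \<in> carrier R" for z
        using that e(1) by algebra
      then show ?thesis
        unfolding ab(3) using jacobson_radicalD(1)[OF z] by simp
    qed
    finally show ?thesis
      using one_minus_jacobson_radical[OF z] by simp
  qed
  have "\<one> \<ominus> e \<otimes> d \<otimes> u \<in> Units R" if u: "u \<in> Units R" for u
  proof -
    define w where "w = \<one> \<ominus> d \<otimes> u"
    have w: "w \<in> Units R" using DeltaD(2)[OF d u] by (simp add: w_def)
    have "?f \<oplus> e \<otimes> w = \<one> \<ominus> e \<otimes> d \<otimes> u"
      unfolding w_def using e(1) dc Units_closed[OF u] by algebra
    moreover have "?f \<oplus> e \<otimes> w \<in> Units R"
    \<comment> \<open>The candidate inverse works only up to a unit, but on both sides, and this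
      suffices.\<close>
    proof (rule Units_if_mult_Units)
      show "(?f \<oplus> e \<otimes> w) \<otimes> (?f \<oplus> e \<otimes> inv w) \<in> Units R"
        using w by (intro prod) auto
      show "(?f \<oplus> e \<otimes> inv w) \<otimes> (?f \<oplus> e \<otimes> w) \<in> Units R"
        using w by (intro prod) auto
    qed (use w f e(1) in \<open>simp_all add: Units_closed\<close>)
    ultimately show ?thesis by simp
  qed
  with e(1) dc show ?thesis by (simp add: Delta_def)
qed

section \<open>\<open>Delta R\<close> lies in the radical, and the quotient is Boolean\<close>

text \<open>Splitting r = e + d' gives rd = ed + d'd in \<open>Delta R\<close>, so 1 - rd is a unit;
  swapping the factors gives 1 - dr.\<close>

lemma Delta_subset_jacobson_radical: "Delta R \<subseteq> jacobson_radical R"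
proof
  fix d assume d: "d \<in> Delta R"
  have dc: "d \<in> carrier R" using d DeltaD by auto
  have "\<one> \<ominus> d \<otimes> r \<in> Units R" if r: "r \<in> carrier R" for r
  proof -
    obtain e d' where e: "e \<in> carrier R" "e \<otimes> e = e" "d' \<in> Delta R" "r = e \<oplus> d'"
      using strongly_Delta_clean r by blast
    have "r \<otimes> d = e \<otimes> d \<oplus> d' \<otimes> d"
      using e DeltaD(1)[OF e(3)] dc by (simp add: l_distr)
    then have "r \<otimes> d \<in> Delta R"
      using Delta_add[OF idem_mult_Delta[OF e(1,2) d] Delta_mult[OF e(3) d]] by simp
    then show ?thesis
      using Units_one_minus_swap[OF r dc] Units_minus_Delta[OF Units_one_closed] by simp
  qed
  with dc show "d \<in> jacobson_radical R" by (simp add: jacobson_radical_def)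
qed

text \<open>For a = e + d, the defect is (ee - e) + (ed + da - d): the first part vanishes and the
  second lies in the ideal.\<close>

lemma boolean_mod_jacobson_radical:
  assumes a: "a \<in> carrier R"
  shows "a \<otimes> a \<ominus> a \<in> jacobson_radical R"
proof -
  obtain e d where ed: "e \<in> carrier R" "e \<otimes> e = e" "d \<in> Delta R" "a = e \<oplus> d"
    using strongly_Delta_clean a by blast
  have d: "d \<in> jacobson_radical R" "d \<in> carrier R"
    using ed(3) Delta_subset_jacobson_radical DeltaD by auto
  have "a \<otimes> a \<ominus> a = e \<otimes> e \<ominus> e \<oplus> (e \<otimes> d \<oplus> d \<otimes> a \<ominus> d)"
    unfolding ed(4) using ed(1) d(2) by algebra
  also have "\<dots> = e \<otimes> d \<oplus> d \<otimes> a \<ominus> d"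
    unfolding ed(2) using ed(1) d(2) a by algebra
  finally show ?thesis
    using jacobson_radical_diff[OF jacobson_radical_add[OF jacobson_radical_l_closed[OF d(1) ed(1)]
          jacobson_radical_r_closed[OF d(1) a]] d(1)] by simp
qed

end

theorem corollary3p9:
  fixes R (structure)
  assumes "strongly_Delta_clean_ring R"
  shows "right_quasi_duo_ring R \<and> left_quasi_duo_ring R"
proof -
  interpret strongly_Delta_clean_ring R by fact
  show ?thesis
    using quasi_duo_if_commutative_mod_jacobson_radical
      commutator_in_jacobson_radical[OF boolean_mod_jacobson_radical] by blast
qed

end
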